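(* Suppose $p=\alpha\frac{\log n}{n}$ and $q=\beta\frac{\log n}{n}$ with constants $\alpha>\beta>0$. Then, with high probability, the LP relaxation fails to recover the planted bisection in $G\sim\mathcal G_{n,p,q}$.
   Context: $\mathcal G_{n,p,q}$ (stochastic block model), for $n$ even: a bisection $V_1,V_2$ (partition into two sets of size $n/2$) of $V=\{1,\dots,n\}$ is chosen uniformly at random, called the planted bisection; then, independently, each pair of nodes in the same part is joined by an edge with probability $p$, and each pair of nodes in different parts is joined by an edge with probability $q$. The parameters $\alpha,\beta$ are independent of $n$. "With high probability" means with probability tending to $1$ as $n\to\infty$ (along even $n$). The LP relaxation (metric relaxation of the minimum bisection problem) associated with a graph $G=(V,E)$ is the following linear program in $x\in\mathbb R^{\binom n2}$, with coordinates $x_{ij}$, $1\le i<j\le n$, and the convention $x_{ji}:=x_{ij}$: $$\min\ \sum_{1\le i<j\le n}a_{ij}x_{ij}$$ subject to $x_{ij}\le x_{ik}+x_{jk}$ for all distinct $i,j,k\in\{1,\dots,n\}$ with $i<j$; $x_{ij}+x_{ik}+x_{jk}\le 2$ for all $1\le i<j<k\le n$; and $\sum_{1\le i<j\le n}x_{ij}=n^2/4$. Here $a_{ij}=1$ if $\{i,j\}\in E$ and $a_{ij}=0$ otherwise. The cut vector corresponding to the planted bisection is $\bar x\in\{0,1\}^{\binom n2}$ with $\bar x_{ij}=0$ if $i,j$ are in the same set of the bisection and $\bar x_{ij}=1$ otherwise. The LP relaxation recovers the planted bisection if $\bar x$ is its unique optimal solution; otherwise it fails to recover it. *)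

theory Defs
  imports "HOL-Probability.Probability" "HOL-Probability.Product_PMF"
begin

text \<open>Unordered pairs of distinct nodes. They serve both as potential edges and as the coordinates
  of the linear program: \<open>x\<^sub>i\<^sub>j\<close> with \<open>i < j\<close> is written \<open>x {i, j}\<close>, so that the convention
  \<open>x\<^sub>j\<^sub>i = x\<^sub>i\<^sub>j\<close> is built in.\<close>

definition node_pairs :: "nat \<Rightarrow> nat set set" where
  "node_pairs n = {{i, j} |i j. 1 \<le> i \<and> i < j \<and> j \<le> n}"

definition bisections :: "nat \<Rightarrow> nat set set set" where
  "bisections n = {{V1, V2} |V1 V2. V1 \<union> V2 = {1..n} \<and> V1 \<inter> V2 = {} \<and>
     2 * card V1 = n \<and> 2 * card V2 = n}"

lemma finite_bisections: "finite (bisections n)"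
proof (rule finite_subset)
  show "bisections n \<subseteq> Pow (Pow {1..n})"
    unfolding bisections_def by blast
qed simp

lemma bisections_nonempty:
  assumes "even n"
  shows "bisections n \<noteq> {}"
proof -
  obtain m where n: "n = 2 * m" using assms by (elim evenE)
  have "{{1..m}, {m+1..2*m}} \<in> bisections n"
    unfolding bisections_def n
    by (intro CollectI exI[of _ "{1..m}"] exI[of _ "{m+1..2*m}"]) auto
  thus ?thesis by blast
qed

definition same_part :: "nat set set \<Rightarrow> nat set \<Rightarrow> bool" where
  "same_part B e \<longleftrightarrow> (\<exists>S\<in>B. e \<subseteq> S)"

text \<open>A sample is the planted bisection together with the edge set of the graph. It is meaningful
  for even \<open>n\<close> only. The Bernoulli distribution of the library clips its parameter to \<open>[0, 1]\<close>.\<close>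

definition sbm :: "nat \<Rightarrow> real \<Rightarrow> real \<Rightarrow> (nat set set \<times> nat set set) pmf" where
  "sbm n p q = do {
     B \<leftarrow> pmf_of_set (bisections n);
     f \<leftarrow> Pi_pmf (node_pairs n) False (\<lambda>e. bernoulli_pmf (if same_part B e then p else q));
     return_pmf (B, {e \<in> node_pairs n. f e})
   }"

text \<open>Vectors are extensional functions on \<^term>\<open>node_pairs n\<close>, so that equality of functions is
  equality of vectors.\<close>

definition lp_feasible :: "nat \<Rightarrow> (nat set \<Rightarrow> real) \<Rightarrow> bool" where
  "lp_feasible n x \<longleftrightarrow>
     x \<in> extensional (node_pairs n) \<and>
     (\<forall>i\<in>{1..n}. \<forall>j\<in>{1..n}. \<forall>k\<in>{1..n}. i < j \<and> k \<noteq> i \<and> k \<noteq> j \<longrightarrow>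
        x {i, j} \<le> x {i, k} + x {j, k}) \<and>
     (\<forall>i\<in>{1..n}. \<forall>j\<in>{1..n}. \<forall>k\<in>{1..n}. i < j \<and> j < k \<longrightarrow>
        x {i, j} + x {i, k} + x {j, k} \<le> 2) \<and>
     (\<Sum>e\<in>node_pairs n. x e) = (real n)\<^sup>2 / 4"

definition lp_objective :: "nat \<Rightarrow> nat set set \<Rightarrow> (nat set \<Rightarrow> real) \<Rightarrow> real" where
  "lp_objective n E x = (\<Sum>e\<in>node_pairs n. (if e \<in> E then 1 else 0) * x e)"

definition lp_optimal :: "nat \<Rightarrow> nat set set \<Rightarrow> (nat set \<Rightarrow> real) \<Rightarrow> bool" where
  "lp_optimal n E x \<longleftrightarrow>
     lp_feasible n x \<and> (\<forall>y. lp_feasible n y \<longrightarrow> lp_objective n E x \<le> lp_objective n E y)"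

definition cut_vector :: "nat \<Rightarrow> nat set set \<Rightarrow> nat set \<Rightarrow> real" where
  "cut_vector n B = restrict (\<lambda>e. if same_part B e then 0 else 1) (node_pairs n)"

definition lp_recovers :: "nat \<Rightarrow> nat set set \<Rightarrow> nat set set \<Rightarrow> bool" where
  "lp_recovers n B E \<longleftrightarrow>
     lp_optimal n E (cut_vector n B) \<and> (\<forall>y. lp_optimal n E y \<longrightarrow> y = cut_vector n B)"

end

theory Submission
  imports Defs "HOL-Real_Asymp.Real_Asymp"
begin

text \<open>With high probability all degrees are at most \<open>\<Delta> = O(log n)\<close>, so for a constant \<open>L\<close> only
  \<open>O(n \<Delta>\<^sup>L) = o(n\<^sup>2)\<close> pairs are at graph distance less than \<open>L\<close>. The graph distance truncated at
  \<open>L\<close> is a metric that equals \<open>L\<close> on almost all pairs, so rescaling it to total weight \<open>n\<^sup>2 / 4\<close>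
  gives values of at most \<open>2 / 3\<close>, which makes the perimeter constraints automatic. On edges
  this feasible point is at most \<open>2 / (3 L)\<close>, hence its objective is \<open>O(n log n / L)\<close>. The planted
  bisection cuts about \<open>\<beta> n log n / 4\<close> edges, which is more once \<open>L\<close> is large.\<close>

section \<open>Exponential moments of edge counts\<close>

text \<open>Independence turns the moment into a product of one-coordinate expectations, and each
  factor is bounded by 1 + x \<le> exp x. The sign of \<open>t\<close> is left free so that both
  tails follow.\<close>

lemma exp_moment_Pi_bernoulli_le:
  fixes t :: real and r :: "'a \<Rightarrow> real"
  assumes "finite I" "A \<subseteq> I" and r: "\<forall>e\<in>I. 0 \<le> r e \<and> r e \<le> 1"
  shows "measure_pmf.expectation (Pi_pmf I False (\<lambda>e. bernoulli_pmf (r e)))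
           (\<lambda>f. exp (t * real (card {e\<in>A. f e}))) \<le> exp ((exp t - 1) * sum r A)"
proof -
  \<comment> \<open>Factors outside \<open>A\<close> are 1, so the product can range over all of
    \<open>I\<close>, as the product formula for \<open>Pi_pmf\<close> requires.\<close>
  define g where "g = (\<lambda>e b. if e \<in> A \<and> b then exp t else (1::real))"
  have fA: "finite A" using assms finite_subset by blast
  have eq: "exp (t * real (card {e\<in>A. f e})) = (\<Prod>e\<in>I. g e (f e))" for f
  proof -
    have "(\<Prod>e\<in>I. g e (f e)) = (\<Prod>e\<in>{e\<in>A. f e}. exp t)"
      unfolding g_def using assms by (intro prod.mono_neutral_cong_right) auto
    also have "\<dots> = exp (t * real (card {e\<in>A. f e}))"
      by (simp add: exp_of_nat2_mult)
    finally show ?thesis by simp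
  qed
  have "measure_pmf.expectation (Pi_pmf I False (\<lambda>e. bernoulli_pmf (r e)))
          (\<lambda>f. \<Prod>e\<in>I. g e (f e))
        = (\<Prod>e\<in>I. measure_pmf.expectation (bernoulli_pmf (r e)) (g e))"
    using assms(1) by (intro expectation_prod_Pi_pmf integrable_measure_pmf_finite)
      (auto simp: g_def)
  also have "\<dots> = (\<Prod>e\<in>I. if e \<in> A then 1 + r e * (exp t - 1) else 1)"
  proof (rule prod.cong)
    fix e assume "e \<in> I"
    then show "measure_pmf.expectation (bernoulli_pmf (r e)) (g e) =
        (if e \<in> A then 1 + r e * (exp t - 1) else 1)"
      using r by (auto simp: g_def algebra_simps)
  qed simp
  also have "\<dots> = (\<Prod>e\<in>A. 1 + r e * (exp t - 1))"
    using assms by (intro prod.mono_neutral_cong_right) auto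
  also have "\<dots> \<le> (\<Prod>e\<in>A. exp (r e * (exp t - 1)))"
  proof (rule prod_mono)
    fix e assume "e \<in> A"
    then have "0 \<le> r e" "r e \<le> 1" using r assms by auto
    \<comment> \<open>A product is monotone only for nonnegative factors; each factor here is a
      convex combination of 1 and exp t.\<close>
    then have "0 \<le> (1 - r e) + r e * exp t" by simp
    then show "0 \<le> 1 + r e * (exp t - 1) \<and> 1 + r e * (exp t - 1) \<le> exp (r e * (exp t - 1))"
      using exp_ge_add_one_self[of "r e * (exp t - 1)"] by (simp add: algebra_simps)
  qed
  also have "\<dots> = exp ((exp t - 1) * sum r A)"
    by (simp add: exp_sum[OF fA, symmetric] sum_distrib_right mult.commute[of _ "sum r A"])
  finally show ?thesis by (simp add: eq)
qed

text \<open>Markov's inequality for exp(t X). Keeping \<open>t\<close> on both sides of the event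
  makes it an upper tail for t > 0 and a lower tail for t < 0.\<close>

lemma chernoff_Pi_bernoulli:
  fixes t a :: real and r :: "'a \<Rightarrow> real"
  assumes "finite I" "A \<subseteq> I" and r: "\<forall>e\<in>I. 0 \<le> r e \<and> r e \<le> 1"
  shows "measure_pmf.prob (Pi_pmf I False (\<lambda>e. bernoulli_pmf (r e)))
           {f. t * a \<le> t * real (card {e\<in>A. f e})} \<le> exp ((exp t - 1) * sum r A - t * a)"
proof -
  let ?M = "Pi_pmf I False (\<lambda>e. bernoulli_pmf (r e))"
  let ?X = "\<lambda>f. exp (t * real (card {e\<in>A. f e}))"
  have fin: "finite (set_pmf ?M)"
    using assms(1) by (simp add: set_Pi_pmf finite_PiE_dflt)
  have "measure_pmf.prob ?M {f \<in> space (measure_pmf ?M). exp (t * a) \<le> ?X f}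
      \<le> measure_pmf.expectation ?M ?X / exp (t * a)"
    by (rule integral_Markov_inequality_measure[where A = "{}"])
      (auto intro: integrable_measure_pmf_finite[OF fin])
  also have "\<dots> \<le> exp ((exp t - 1) * sum r A) / exp (t * a)"
    by (intro divide_right_mono exp_moment_Pi_bernoulli_le assms) auto
  finally show ?thesis by (simp add: exp_diff)
qed

text \<open>The choice t = 1 with exp 1 - 1 \<le> 2. No optimisation over \<open>t\<close> is
  attempted: \<open>a\<close> will be a large enough multiple of the mean.\<close>

lemma upper_tail_Pi_bernoulli:
  fixes a :: real and r :: "'a \<Rightarrow> real"
  assumes "finite I" "A \<subseteq> I" and r: "\<forall>e\<in>I. 0 \<le> r e \<and> r e \<le> 1"
  shows "measure_pmf.prob (Pi_pmf I False (\<lambda>e. bernoulli_pmf (r e)))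
           {f. a \<le> real (card {e\<in>A. f e})} \<le> exp (2 * sum r A - a)"
proof -
  have "0 \<le> sum r A" using assms by (intro sum_nonneg) auto
  then have "(exp 1 - 1) * sum r A \<le> 2 * sum r A"
    using exp_le by (intro mult_right_mono) auto
  then show ?thesis
    using chernoff_Pi_bernoulli[OF assms, where t = 1 and a = a]
    by (auto elim!: order_trans)
qed

text \<open>The choice t = -1 with exp(-1) \<le> 1/2; informative when \<open>a\<close> lies below
  half the mean.\<close>

lemma lower_tail_Pi_bernoulli:
  fixes a :: real and r :: "'a \<Rightarrow> real"
  assumes "finite I" "A \<subseteq> I" and r: "\<forall>e\<in>I. 0 \<le> r e \<and> r e \<le> 1"
  shows "measure_pmf.prob (Pi_pmf I False (\<lambda>e. bernoulli_pmf (r e)))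
           {f. real (card {e\<in>A. f e}) \<le> a} \<le> exp (a - sum r A / 2)"
proof -
  have "0 \<le> sum r A" using assms by (intro sum_nonneg) auto
  moreover have "exp (-1) \<le> (1/2::real)"
    using exp_ge_add_one_self[of 1] by (simp add: exp_minus field_simps)
  ultimately have "(exp (-1) - 1) * sum r A \<le> (- 1/2) * sum r A"
    by (intro mult_right_mono) auto
  then have "exp ((exp (-1) - 1) * sum r A - (-1) * a) \<le> exp (a - sum r A / 2)"
    by simp
  then show ?thesis
    using chernoff_Pi_bernoulli[OF assms, where t = "-1" and a = a]
    by (auto elim!: order_trans)
qed

section \<open>Node pairs\<close>

lemma node_pairs_eq: "node_pairs n = {e. e \<subseteq> {1..n} \<and> card e = 2}"
proof (intro set_eqI iffI)
  fix e assume "e \<in> {e. e \<subseteq> {1..n} \<and> card e = 2}"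
  then obtain i j where ij: "e = {i, j}" "i \<noteq> j" "e \<subseteq> {1..n}"
    by (auto simp: card_2_iff)
  show "e \<in> node_pairs n"
  proof (cases "i < j")
    case True
    then show ?thesis using ij by (auto simp: node_pairs_def)
  next
    case False
    then have "e = {j, i}" "j < i" using ij by auto
    then show ?thesis using ij by (auto simp: node_pairs_def)
  qed
qed (auto simp: node_pairs_def)

lemma pair_in_node_pairs: "{i, j} \<in> node_pairs n \<longleftrightarrow> i \<in> {1..n} \<and> j \<in> {1..n} \<and> i \<noteq> j"
  by (auto simp: node_pairs_eq card_insert_if)

lemma finite_node_pairs [simp]: "finite (node_pairs n)"
  by (rule finite_subset[of _ "Pow {1..n}"]) (auto simp: node_pairs_eq)

lemma card_node_pairs: "real (card (node_pairs n)) = real n * (real n - 1) / 2"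
proof -
  have "card (node_pairs n) = n choose 2"
    unfolding node_pairs_eq by (subst n_subsets) auto
  then have "real (card (node_pairs n)) = real (n * (n - 1) div 2)"
    by (simp add: choose_two)
  also have "\<dots> = real (n * (n - 1)) / real 2"
    by (rule real_of_nat_div) (cases n; simp)
  finally show ?thesis by (cases n) (auto simp: algebra_simps)
qed

lemma card_incident_le: "card {e \<in> node_pairs n. i \<in> e} \<le> n"
proof -
  have "{e \<in> node_pairs n. i \<in> e} \<subseteq> (\<lambda>j. {i, j}) ` {1..n}"
    by (fastforce simp: node_pairs_def insert_commute)
  then have "card {e \<in> node_pairs n. i \<in> e} \<le> card {1..n}"
    by (rule surj_card_le[rotated]) simp
  then show ?thesis by simp
qed

text \<open>The product V \<times> W of the two parts, of size (n/2)^2, embeds into the crossing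
  pairs.\<close>

lemma cut_pairs:
  assumes "B \<in> bisections n"
  shows "real (card {e \<in> node_pairs n. \<not> same_part B e}) \<ge> (real n)\<^sup>2 / 4"
proof -
  obtain V W where B: "B = {V, W}" "V \<union> W = {1..n}" "V \<inter> W = {}" "2 * card V = n" "2 * card W = n"
    using assms by (auto simp: bisections_def)
  have inj: "inj_on (\<lambda>(i, j). {i, j}) (V \<times> W)"
    using B(3) by (auto simp: inj_on_def doubleton_eq_iff)
  have sub: "(\<lambda>(i, j). {i, j}) ` (V \<times> W) \<subseteq> {e \<in> node_pairs n. \<not> same_part B e}"
  proof clarify
    fix i j assume ij: "i \<in> V" "j \<in> W"
    then have "i \<in> {1..n}" "j \<in> {1..n}" "i \<notin> W" "j \<notin> V" using B(2,3) by blast+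
    then show "{i, j} \<in> node_pairs n \<and> \<not> same_part B {i, j}"
      using ij by (auto simp: pair_in_node_pairs same_part_def B(1) simp del: atLeastAtMost_iff)
  qed
  have "card V * card W = card ((\<lambda>(i, j). {i, j}) ` (V \<times> W))"
    by (simp only: card_image[OF inj] card_cartesian_product)
  also have "\<dots> \<le> card {e \<in> node_pairs n. \<not> same_part B e}"
    by (rule card_mono[OF _ sub]) simp
  finally have "real (card V) * real (card W) \<le> real (card {e \<in> node_pairs n. \<not> same_part B e})"
    by (simp flip: of_nat_mult)
  moreover have "real n = 2 * real (card V)" using B(4) by linarith
  moreover have "real n = 2 * real (card W)" using B(5) by linarith
  ultimately show ?thesis by (simp add: power2_eq_square)
qed

section \<open>Truncated graph distance\<close>

definition adj :: "nat set set \<Rightarrow> nat rel" where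
  "adj E = {(i, j). {i, j} \<in> E}"

text \<open>The disjunct \<open>k = L\<close> does the truncation and also guarantees that the least
  element exists when no walk joins \<open>i\<close> and \<open>j\<close>. The relation power allows
  walks, but a shortest walk is a path.\<close>

definition tdist :: "nat set set \<Rightarrow> nat \<Rightarrow> nat \<Rightarrow> nat \<Rightarrow> nat" where
  "tdist E L i j = (LEAST k. k = L \<or> (i, j) \<in> adj E ^^ k)"

lemma tdist_le: "tdist E L i j \<le> L"
  unfolding tdist_def by (rule Least_le) simp

lemma tdist_relpow_le: "(i, j) \<in> adj E ^^ k \<Longrightarrow> tdist E L i j \<le> k"
  unfolding tdist_def by (rule Least_le) simp

lemma tdist_cases: "tdist E L i j = L \<or> (i, j) \<in> adj E ^^ tdist E L i j"
  unfolding tdist_def by (rule LeastI[of _ L]) simp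

lemma adj_relpow_sym: "(i, j) \<in> adj E ^^ k \<longleftrightarrow> (j, i) \<in> adj E ^^ k"
proof -
  have "(j, i) \<in> adj E ^^ k" if "(i, j) \<in> adj E ^^ k" for i j
    using that
  proof (induction k arbitrary: j)
    case (Suc k)
    then obtain l where "(i, l) \<in> adj E ^^ k" "(l, j) \<in> adj E" by auto
    moreover from this have "(j, l) \<in> adj E" by (simp add: adj_def insert_commute)
    ultimately show ?case using Suc.IH relpow_Suc_I2 by metis
  qed simp
  then show ?thesis by blast
qed

lemma tdist_sym: "tdist E L i j = tdist E L j i"
  unfolding tdist_def using adj_relpow_sym[of i j] by simp

text \<open>If one leg is truncated, the right-hand side is already at least \<open>L\<close>;
  otherwise the two walks concatenate.\<close>

lemma tdist_triangle: "tdist E L i j \<le> tdist E L i k + tdist E L j k"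
proof (cases "tdist E L i k = L \<or> tdist E L j k = L")
  case True
  then show ?thesis using tdist_le[of E L i j] by auto
next
  case False
  then have "(i, k) \<in> adj E ^^ tdist E L i k" "(k, j) \<in> adj E ^^ tdist E L j k"
    using tdist_cases tdist_cases[of E L j k] adj_relpow_sym by blast+
  then have "(i, j) \<in> adj E ^^ (tdist E L i k + tdist E L j k)"
    by (auto simp: relpow_add)
  then show ?thesis by (rule tdist_relpow_le)
qed

lemma tdist_edge: "{i, j} \<in> E \<Longrightarrow> tdist E L i j \<le> 1"
  by (rule tdist_relpow_le) (simp add: adj_def)

text \<open>Each further step multiplies the number of reachable endpoints by at most the maximum
  degree. Finiteness is carried along because \<open>adj E\<close> is a relation on all
  naturals.\<close>

lemma card_relpow_le:
  assumes "finite E" "E \<subseteq> node_pairs n" and deg: "\<forall>i\<in>{1..n}. real (card {e\<in>E. i \<in> e}) \<le> \<Delta>"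
    and "0 \<le> \<Delta>"
  shows "finite ((adj E ^^ k) `` {i}) \<and> real (card ((adj E ^^ k) `` {i})) \<le> \<Delta> ^ k"
proof (induction k)
  case 0
  then show ?case by simp
next
  case (Suc k)
  let ?S = "(adj E ^^ k) `` {i}"
  \<comment> \<open>Neighbours \<open>l\<close> of \<open>j\<close> correspond injectively to the
    incident edges \<open>{j, l}\<close>. A \<open>j\<close> outside the node set has none, so the
    degree bound extends to every natural number.\<close>
  have nb: "finite (adj E `` {j}) \<and> real (card (adj E `` {j})) \<le> \<Delta>" for j
  proof -
    have inj: "inj_on (\<lambda>l. {j, l}) (adj E `` {j})"
      by (auto simp: inj_on_def doubleton_eq_iff)
    have sub: "(\<lambda>l. {j, l}) ` (adj E `` {j}) \<subseteq> {e\<in>E. j \<in> e}"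
      by (auto simp: adj_def)
    have fin: "finite {e\<in>E. j \<in> e}" using assms(1) by simp
    have f: "finite (adj E `` {j})"
      using finite_imageD[OF finite_subset[OF sub fin] inj] .
    have "card (adj E `` {j}) \<le> card {e\<in>E. j \<in> e}"
      using card_mono[OF fin sub] card_image[OF inj] by simp
    moreover have "real (card {e\<in>E. j \<in> e}) \<le> \<Delta>"
    proof (cases "j \<in> {1..n}")
      case True
      then show ?thesis using deg by blast
    next
      case False
      then have "{e\<in>E. j \<in> e} = {}" using assms(2) by (fastforce simp: node_pairs_eq)
      then show ?thesis using assms(4) by (simp only: card.empty of_nat_0)
    qed
    ultimately show ?thesis using f by simp
  qed
  have eq: "(adj E ^^ Suc k) `` {i} = (\<Union>j\<in>?S. adj E `` {j})" by auto
  have "real (card (\<Union>j\<in>?S. adj E `` {j})) \<le> (\<Sum>j\<in>?S. real (card (adj E `` {j})))"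
    using card_UN_le[of ?S "\<lambda>j. adj E `` {j}"] Suc by (simp flip: of_nat_sum)
  also have "\<dots> \<le> (\<Sum>j\<in>?S. \<Delta>)" using nb by (intro sum_mono) auto
  also have "\<dots> \<le> \<Delta> ^ k * \<Delta>" using Suc assms(4) by (simp add: mult_right_mono)
  finally show ?case using Suc nb unfolding eq by (simp add: mult.commute)
qed

text \<open>A node at truncated distance k < L is the end of a walk of length k, so the ball is
  covered by the endpoint sets for k < L.\<close>

lemma card_ball_le:
  assumes "finite E" "E \<subseteq> node_pairs n" and "\<forall>i\<in>{1..n}. real (card {e\<in>E. i \<in> e}) \<le> \<Delta>"
    and "0 \<le> \<Delta>"
  shows "finite {j. tdist E L i j < L} \<and> real (card {j. tdist E L i j < L}) \<le> (\<Sum>k<L. \<Delta> ^ k)"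
proof -
  let ?U = "\<Union>k<L. (adj E ^^ k) `` {i}"
  have sub: "{j. tdist E L i j < L} \<subseteq> ?U"
  proof
    fix j assume "j \<in> {j. tdist E L i j < L}"
    then show "j \<in> ?U" using tdist_cases[of E L i j] by fastforce
  qed
  have fin: "finite ?U" using card_relpow_le[OF assms] by auto
  have "real (card ?U) \<le> (\<Sum>k<L. real (card ((adj E ^^ k) `` {i})))"
    using card_UN_le[of "{..<L}" "\<lambda>k. (adj E ^^ k) `` {i}"] by (simp flip: of_nat_sum)
  also have "\<dots> \<le> (\<Sum>k<L. \<Delta> ^ k)" using card_relpow_le[OF assms] by (intro sum_mono) auto
  finally show ?thesis using card_mono[OF fin sub] finite_subset[OF sub fin] by linarith
qed

section \<open>Low-degree graphs are not recovered\<close>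

text \<open>Taking \<open>Min\<close> and \<open>Max\<close> only picks an order of the two nodes; the distance is symmetric.\<close>

definition dist_vec :: "nat set set \<Rightarrow> nat \<Rightarrow> nat set \<Rightarrow> real" where
  "dist_vec E L e = real (tdist E L (Min e) (Max e))"

lemma dist_vec_pair: "i \<noteq> j \<Longrightarrow> dist_vec E L {i, j} = real (tdist E L i j)"
  unfolding dist_vec_def using tdist_sym[of E L i j] by (auto simp: min_def max_def)

lemma dist_vec_le: "dist_vec E L e \<le> real L"
  by (simp add: dist_vec_def tdist_le)

lemma dist_vec_nonneg: "0 \<le> dist_vec E L e"
  by (simp add: dist_vec_def)

lemma dist_vec_edge:
  assumes "e \<in> E" "E \<subseteq> node_pairs n"
  shows "dist_vec E L e \<le> 1"
proof -
  obtain i j where "e = {i, j}" "i \<noteq> j" using assms by (auto simp: node_pairs_def)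
  then show ?thesis using assms tdist_edge[of i j E L] by (simp add: dist_vec_pair)
qed

text \<open>At most n * n/16 pairs lie closer than \<open>L\<close>. The remaining pairs, at least
  3/8 n^2 of them, contribute \<open>L\<close> each.\<close>

lemma sum_dist_vec_ge:
  assumes E: "E \<subseteq> node_pairs n" and deg: "\<forall>i\<in>{1..n}. real (card {e\<in>E. i \<in> e}) \<le> \<Delta>"
    and "0 \<le> \<Delta>" and "L \<ge> 1" and small: "(\<Sum>k<L. \<Delta> ^ k) \<le> real n / 16"
  shows "(\<Sum>e\<in>node_pairs n. dist_vec E L e) \<ge> 3 / 8 * (real n)\<^sup>2 * real L"
proof -
  let ?N = "node_pairs n" and ?M = "\<Sum>k<L. \<Delta> ^ k"
  have fE: "finite E" using finite_subset[OF E] by simp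
  note ball = card_ball_le[OF fE E deg \<open>0 \<le> \<Delta>\<close>]
  \<comment> \<open>Close pairs and far pairs. Every close pair is charged to the ball around one of
    its nodes.\<close>
  define C where "C = {e\<in>?N. dist_vec E L e < L}"
  define F where "F = {e\<in>?N. dist_vec E L e = L}"
  have "C \<subseteq> (\<Union>i\<in>{1..n}. (\<lambda>j. {i, j}) ` {j. tdist E L i j < L})"
  proof
    fix e assume e: "e \<in> C"
    then obtain i j where ij: "e = {i, j}" "i \<noteq> j" "i \<in> {1..n}"
      unfolding C_def node_pairs_def by fastforce
    then have "j \<in> {j. tdist E L i j < L}" using e by (simp add: C_def dist_vec_pair)
    then show "e \<in> (\<Union>i\<in>{1..n}. (\<lambda>j. {i, j}) ` {j. tdist E L i j < L})"
      using ij by blast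
  qed
  then have "card C \<le> card (\<Union>i\<in>{1..n}. (\<lambda>j. {i, j}) ` {j. tdist E L i j < L})"
    using ball by (intro card_mono) auto
  also have "\<dots> \<le> (\<Sum>i\<in>{1..n}. card ((\<lambda>j. {i, j}) ` {j. tdist E L i j < L}))"
    by (rule card_UN_le) simp
  also have "\<dots> \<le> (\<Sum>i\<in>{1..n}. card {j. tdist E L i j < L})"
    using ball by (intro sum_mono card_image_le) auto
  finally have "real (card C) \<le> (\<Sum>i\<in>{1..n}. real (card {j. tdist E L i j < L}))"
    by (simp flip: of_nat_sum)
  also have "\<dots> \<le> (\<Sum>i\<in>{1..n}. ?M)" using ball by (intro sum_mono) auto
  finally have C: "real (card C) \<le> real n * ?M" by simp
  have "?N = C \<union> F" "C \<inter> F = {}"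
    unfolding C_def F_def using dist_vec_le[of E L] by (auto simp: order_less_le)
  then have "card ?N = card C + card F"
    by (metis card_Un_disjoint finite_Un finite_node_pairs)
  then have "real (card F) \<ge> real n * (real n - 1) / 2 - real n * ?M"
    using C card_node_pairs[of n] by simp
  \<comment> \<open>The summand k = 0 is 1. With \<open>small\<close> this forces n \<ge> 16, which
    absorbs the lower-order term of n (n - 1) / 2.\<close>
  moreover have "?M \<ge> 1"
    using \<open>L \<ge> 1\<close> \<open>0 \<le> \<Delta>\<close> member_le_sum[of 0 "{..<L}" "\<lambda>k. \<Delta> ^ k"] by simp
  then have "real n * (real n - 1) / 2 - real n * ?M \<ge> real n * (real n * 3 / 8)"
  proof -
    have "x * 3 / 8 \<le> (x - 1) / 2 - m" if "m \<le> x / 16" "1 \<le> m" for x m :: real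
      using that by (simp add: field_simps)
    then have "real n * 3 / 8 \<le> (real n - 1) / 2 - ?M" using small \<open>?M \<ge> 1\<close> by blast
    from mult_left_mono[OF this, of "real n"] show ?thesis by (simp add: algebra_simps)
  qed
  ultimately have "real (card F) \<ge> 3 / 8 * (real n)\<^sup>2" by (simp add: power2_eq_square)
  then have "3 / 8 * (real n)\<^sup>2 * real L \<le> real (card F) * real L" by (rule mult_right_mono) simp
  also have "\<dots> = (\<Sum>e\<in>F. dist_vec E L e)" by (simp add: F_def)
  also have "\<dots> \<le> (\<Sum>e\<in>?N. dist_vec E L e)"
    by (rule sum_mono2) (auto simp: F_def dist_vec_nonneg)
  finally show ?thesis .
qed

text \<open>A feasible point with a strictly smaller objective already refutes optimality of the cut
  vector. The left side of \<open>cut\<close> bounds the objective of the rescaled distance vector,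
  the right side is that of the cut vector.\<close>

lemma not_lp_recovers:
  assumes E: "E \<subseteq> node_pairs n" and deg: "\<forall>i\<in>{1..n}. real (card {e\<in>E. i \<in> e}) \<le> \<Delta>"
    and "0 \<le> \<Delta>" and "L \<ge> 1" and small: "(\<Sum>k<L. \<Delta> ^ k) \<le> real n / 16" and "n > 0"
    and cut: "2 / 3 * real n * \<Delta> / L < real (card {e\<in>E. \<not> same_part B e})"
  shows "\<not> lp_recovers n B E"
proof -
  let ?N = "node_pairs n" and ?d = "dist_vec E L"
  have fE: "finite E" using finite_subset[OF E] by simp
  define T where "T = (\<Sum>e\<in>?N. ?d e)"
  have T: "T \<ge> 3 / 8 * (real n)\<^sup>2 * real L"
    unfolding T_def using assms by (intro sum_dist_vec_ge) auto
  moreover have "3 / 8 * (real n)\<^sup>2 * real L > 0" using \<open>n > 0\<close> \<open>L \<ge> 1\<close> by simp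
  ultimately have "T > 0" by linarith
  \<comment> \<open>The factor that brings the total weight to n^2 / 4.\<close>
  define c where "c = (real n)\<^sup>2 / (4 * T)"
  have "c \<ge> 0" using \<open>T > 0\<close> by (simp add: c_def)
  \<comment> \<open>Here the constant 3/8 pays off: (1/4) / (3/8) = 2/3, so no coordinate exceeds
    2/3 and no three sum to more than 2.\<close>
  have cL: "c * L \<le> 2 / 3"
    using T \<open>T > 0\<close> \<open>L \<ge> 1\<close> by (simp add: c_def field_simps)
  define y where "y = restrict (\<lambda>e. c * ?d e) ?N"
  have y_pair: "y {i, j} = c * real (tdist E L i j)"
    if "i \<in> {1..n}" "j \<in> {1..n}" "i \<noteq> j" for i j
    using that by (simp add: y_def pair_in_node_pairs dist_vec_pair del: atLeastAtMost_iff)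
  have y_le: "c * real (tdist E L i j) \<le> 2 / 3" for i j
    using mult_left_mono[OF _ \<open>c \<ge> 0\<close>, of "real (tdist E L i j)" L] cL by (simp add: tdist_le)
  have feas: "lp_feasible n y"
    unfolding lp_feasible_def
  proof (intro conjI ballI impI)
    show "y \<in> extensional ?N" by (simp add: y_def)
  next
    fix i j k assume *: "i \<in> {1..n}" "j \<in> {1..n}" "k \<in> {1..n}" "i < j \<and> k \<noteq> i \<and> k \<noteq> j"
    have "c * real (tdist E L i j) \<le> c * real (tdist E L i k + tdist E L j k)"
      using tdist_triangle \<open>c \<ge> 0\<close> by (intro mult_left_mono of_nat_mono)
    then show "y {i, j} \<le> y {i, k} + y {j, k}"
      using * y_pair[of i j] y_pair[of i k] y_pair[of j k] by (simp add: distrib_left)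
  next
    fix i j k assume *: "i \<in> {1..n}" "j \<in> {1..n}" "k \<in> {1..n}" "i < j \<and> j < k"
    then show "y {i, j} + y {i, k} + y {j, k} \<le> 2"
      using y_pair[of i j] y_pair[of i k] y_pair[of j k] y_le[of i j] y_le[of i k] y_le[of j k]
      by simp
  next
    have "sum y ?N = c * T" by (simp add: y_def T_def sum_distrib_left)
    then show "sum y ?N = (real n)\<^sup>2 / 4" using \<open>T > 0\<close> by (simp add: c_def)
  qed
  have obj: "lp_objective n E x = sum x E" for x
    unfolding lp_objective_def using E by (intro sum.mono_neutral_cong_right) auto
  have "lp_objective n E y \<le> (\<Sum>e\<in>E. c)"
    unfolding obj
  proof (rule sum_mono)
    fix e assume "e \<in> E"
    then show "y e \<le> c"
      using E dist_vec_edge[OF _ E] \<open>c \<ge> 0\<close> by (auto simp: y_def mult_left_le)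
  qed
  also have "\<dots> = c * real (card E)" by simp
  also have "\<dots> \<le> 2 / 3 / L * (real n * \<Delta>)"
  proof (rule mult_mono)
    show "c \<le> 2 / 3 / L" using cL \<open>L \<ge> 1\<close> by (simp add: field_simps)
    \<comment> \<open>Every edge is incident to some node, so summing degrees gives at most n
      \<Delta> edges; the factor 2 from handshaking is given away.\<close>
    have "E \<subseteq> (\<Union>i\<in>{1..n}. {e\<in>E. i \<in> e})"
      using E by (fastforce simp: node_pairs_def)
    then have "card E \<le> card (\<Union>i\<in>{1..n}. {e\<in>E. i \<in> e})"
      using fE by (intro card_mono) auto
    also have "\<dots> \<le> (\<Sum>i\<in>{1..n}. card {e\<in>E. i \<in> e})" by (rule card_UN_le) simp
    finally have "real (card E) \<le> (\<Sum>i\<in>{1..n}. real (card {e\<in>E. i \<in> e}))"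
      by (simp flip: of_nat_sum)
    also have "\<dots> \<le> (\<Sum>i\<in>{1..n}. \<Delta>)" using deg by (intro sum_mono) auto
    finally show "real (card E) \<le> real n * \<Delta>" by simp
  qed auto
  also have "\<dots> < real (card {e\<in>E. \<not> same_part B e})" using cut by simp
  also have "\<dots> = (\<Sum>e\<in>{e\<in>E. \<not> same_part B e}. 1)" by simp
  also have "\<dots> = lp_objective n E (cut_vector n B)"
    unfolding obj cut_vector_def using E fE by (intro sum.mono_neutral_cong_left) auto
  finally show ?thesis
    using feas by (auto simp: lp_recovers_def lp_optimal_def not_le[symmetric])
qed

section \<open>The stochastic block model\<close>

text \<open>For a fixed bisection, recovery forces a node of degree at least \<Delta> or at most q
  n^2 / 16 crossing edges. A union bound over the nodes and this one further event gives the two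
  terms.\<close>

lemma prob_sbm_recovers_le:
  assumes B: "B \<in> bisections n" and q: "0 \<le> q" "q \<le> p" "p \<le> 1"
    and "0 \<le> \<Delta>" "L \<ge> 1" "n > 0"
    and small: "(\<Sum>k<L. \<Delta> ^ k) \<le> real n / 16" and cut: "2 / 3 * real n * \<Delta> / L < q * (real n)\<^sup>2 / 16"
  shows "measure_pmf.prob
      (Pi_pmf (node_pairs n) False (\<lambda>e. bernoulli_pmf (if same_part B e then p else q)))
      {f. lp_recovers n B {e\<in>node_pairs n. f e}}
    \<le> real n * exp (2 * (real n * p) - \<Delta>) + exp (- (q * (real n)\<^sup>2 / 16))"
proof -
  let ?N = "node_pairs n" and ?r = "\<lambda>e. if same_part B e then p else q"
  let ?M = "Pi_pmf ?N False (\<lambda>e. bernoulli_pmf (?r e))"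
  have r: "0 \<le> ?r e \<and> ?r e \<le> 1" for e using q by auto
  define H where "H i = {f. \<Delta> \<le> real (card {e\<in>{e\<in>?N. i \<in> e}. f e})}" for i
  let ?X = "{e\<in>?N. \<not> same_part B e}"
  \<comment> \<open>The threshold is a quarter of q n^2 / 4, which bounds the mean from below; the
    lower-tail exponent is then at most q n^2 / 16 - q n^2 / 8.\<close>
  define K where "K = {f. real (card {e\<in>?X. f e}) \<le> q * (real n)\<^sup>2 / 16}"
  have "{f. lp_recovers n B {e\<in>?N. f e}} \<subseteq> (\<Union>i\<in>{1..n}. H i) \<union> K"
  proof (rule subsetI, rule ccontr)
    fix f assume f: "f \<in> {f. lp_recovers n B {e\<in>?N. f e}}" "f \<notin> (\<Union>i\<in>{1..n}. H i) \<union> K"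
    have "\<not> lp_recovers n B {e\<in>?N. f e}"
    proof (rule not_lp_recovers[where \<Delta> = \<Delta> and L = L])
      have "{e\<in>{e\<in>?N. f e}. i \<in> e} = {e\<in>{e\<in>?N. i \<in> e}. f e}" for i by auto
      then show "\<forall>i\<in>{1..n}. real (card {e\<in>{e\<in>?N. f e}. i \<in> e}) \<le> \<Delta>"
        using f by (auto simp: H_def not_le intro: less_imp_le)
    next
      have "{e\<in>{e\<in>?N. f e}. \<not> same_part B e} = {e\<in>?X. f e}" by auto
      then show "2 / 3 * real n * \<Delta> / L < real (card {e\<in>{e\<in>?N. f e}. \<not> same_part B e})"
        using f cut by (simp add: K_def)
    qed (use assms in auto)
    then show False using f by simp
  qed
  then have "measure_pmf.prob ?M {f. lp_recovers n B {e\<in>?N. f e}}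
      \<le> measure_pmf.prob ?M ((\<Union>i\<in>{1..n}. H i) \<union> K)"
    by (rule measure_pmf.finite_measure_mono) simp
  also have "\<dots> \<le> measure_pmf.prob ?M (\<Union>i\<in>{1..n}. H i) + measure_pmf.prob ?M K"
    by (rule measure_Un_le) auto
  also have "measure_pmf.prob ?M (\<Union>i\<in>{1..n}. H i) \<le> (\<Sum>i\<in>{1..n}. measure_pmf.prob ?M (H i))"
    by (rule measure_UNION_le) auto
  also have "\<dots> \<le> (\<Sum>i\<in>{1..n}. exp (2 * (real n * p) - \<Delta>))"
  proof (rule sum_mono)
    fix i assume "i \<in> {1..n}"
    have "sum ?r {e\<in>?N. i \<in> e} \<le> (\<Sum>e\<in>{e\<in>?N. i \<in> e}. p)"
      using q by (intro sum_mono) auto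
    also have "\<dots> \<le> real n * p"
      using card_incident_le[of n i] q by (simp add: mult_right_mono)
    finally have "exp (2 * sum ?r {e\<in>?N. i \<in> e} - \<Delta>) \<le> exp (2 * (real n * p) - \<Delta>)" by simp
    moreover have "measure_pmf.prob ?M (H i) \<le> exp (2 * sum ?r {e\<in>?N. i \<in> e} - \<Delta>)"
      unfolding H_def by (rule upper_tail_Pi_bernoulli) (use r in auto)
    ultimately show "measure_pmf.prob ?M (H i) \<le> exp (2 * (real n * p) - \<Delta>)" by linarith
  qed
  also have "measure_pmf.prob ?M K \<le> exp (- (q * (real n)\<^sup>2 / 16))"
  proof -
    have "sum ?r ?X = q * real (card ?X)" by simp
    moreover have "q * ((real n)\<^sup>2 / 4) \<le> q * real (card ?X)"
      using cut_pairs[OF B] q by (intro mult_left_mono) auto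
    ultimately have "q * (real n)\<^sup>2 / 16 - sum ?r ?X / 2 \<le> - (q * (real n)\<^sup>2 / 16)"
      using q by (simp add: field_simps)
    then have "exp (q * (real n)\<^sup>2 / 16 - sum ?r ?X / 2) \<le> exp (- (q * (real n)\<^sup>2 / 16))" by simp
    moreover have "measure_pmf.prob ?M K \<le> exp (q * (real n)\<^sup>2 / 16 - sum ?r ?X / 2)"
      unfolding K_def by (rule lower_tail_Pi_bernoulli) (use r in auto)
    ultimately show ?thesis by linarith
  qed
  finally show ?thesis by simp
qed

text \<open>Conditioning on the planted bisection: a bound uniform in \<open>B\<close> survives
  averaging. Evenness makes \<open>bisections n\<close> nonempty, so that \<open>pmf_of_set\<close>
  is the uniform distribution.\<close>

lemma prob_sbm_le:
  assumes "even n"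
    and bound: "\<And>B. B \<in> bisections n \<Longrightarrow> measure_pmf.prob
      (Pi_pmf (node_pairs n) False (\<lambda>e. bernoulli_pmf (if same_part B e then p else q)))
      {f. P B {e\<in>node_pairs n. f e}} \<le> \<epsilon>"
  shows "measure_pmf.prob (sbm n p q) {(B, E). P B E} \<le> \<epsilon>"
proof -
  let ?M = "\<lambda>B. Pi_pmf (node_pairs n) False (\<lambda>e. bernoulli_pmf (if same_part B e then p else q))"
  obtain B0 where "B0 \<in> bisections n" using bisections_nonempty[OF assms(1)] by blast
  \<comment> \<open>Needed for passing between \<open>real\<close> and \<open>ennreal\<close>
    below.\<close>
  then have "0 \<le> \<epsilon>" using bound measure_nonneg order_trans by blast
  have "emeasure (measure_pmf (sbm n p q)) {(B, E). P B E} =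
      (\<integral>\<^sup>+B. emeasure (measure_pmf (?M B)) {f. P B {e\<in>node_pairs n. f e}} \<partial>measure_pmf (pmf_of_set (bisections n)))"
    unfolding sbm_def map_pmf_def[symmetric] emeasure_bind_pmf
    by (simp add: vimage_def)
  also have "\<dots> \<le> (\<integral>\<^sup>+B. ennreal \<epsilon> \<partial>measure_pmf (pmf_of_set (bisections n)))"
    using bound by (intro nn_integral_mono_AE)
      (simp add: AE_measure_pmf_iff measure_pmf.emeasure_eq_measure ennreal_leI
        bisections_nonempty[OF assms(1)] finite_bisections)
  finally show ?thesis using \<open>0 \<le> \<epsilon>\<close> by (simp add: measure_pmf.emeasure_eq_measure)
qed

section \<open>Choice of constants and passage to the limit\<close>

theorem theorem8:
  fixes \<alpha> \<beta> :: real
  assumes "\<alpha> > \<beta>" and "\<beta> > 0"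
  shows "((\<lambda>n. measure_pmf.prob
             (sbm n (\<alpha> * (ln (real n) / real n)) (\<beta> * (ln (real n) / real n)))
             {(B, E). \<not> lp_recovers n B E}) \<longlongrightarrow> 1)
           (inf sequentially (principal {n. even n}))"
proof -
  let ?F = "inf sequentially (principal {n::nat. even n})"
  \<comment> \<open>The degree bound will be K ln n. The upper-tail exponent 2 \<alpha> ln n - K ln
    n is then -2 ln n, so the union bound over n nodes leaves 1/n.\<close>
  define K where "K = 2 * \<alpha> + 2"
  have "K > 0" using assms by (simp add: K_def)
  \<comment> \<open>The constant \<open>L\<close> is chosen so that \<open>cutc\<close> holds;
    multiplied by n ln n, it becomes the objective comparison.\<close>
  obtain L :: nat where L: "real L > 32 * K / (3 * \<beta>)" using reals_Archimedean2 by blast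
  have "32 * K / (3 * \<beta>) > 0" using \<open>K > 0\<close> assms by simp
  then have "L \<ge> 1" "real L > 0" using L by (cases L; simp)+
  have cutc: "2 / 3 * K / L < \<beta> / 16"
    using L \<open>real L > 0\<close> assms by (simp add: field_simps)
  let ?P = "\<lambda>n. measure_pmf.prob
             (sbm n (\<alpha> * (ln (real n) / real n)) (\<beta> * (ln (real n) / real n)))"
  let ?lo = "\<lambda>n. 1 - (1 / real n + exp (- (\<beta> * (real n * ln (real n)) / 16)))"
  have le1: "?P n {(B, E). lp_recovers n B E} \<le> 1 / real n + exp (- (\<beta> * (real n * ln (real n)) / 16))"
    if "even n" "n \<ge> 2" and p1: "\<alpha> * (ln (real n) / real n) \<le> 1"
      and small: "(\<Sum>k<L. (K * ln (real n)) ^ k) \<le> real n / 16" for n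
  proof (rule prob_sbm_le[OF \<open>even n\<close>])
    fix B assume B: "B \<in> bisections n"
    let ?p = "\<alpha> * (ln (real n) / real n)" and ?q = "\<beta> * (ln (real n) / real n)"
    have n: "real n > 0" "ln (real n) > 0" using \<open>n \<ge> 2\<close> by auto
    have qn: "?q * (real n)\<^sup>2 = \<beta> * (real n * ln (real n))"
      using n by (simp add: power2_eq_square)
    have "measure_pmf.prob
      (Pi_pmf (node_pairs n) False (\<lambda>e. bernoulli_pmf (if same_part B e then ?p else ?q)))
      {f. lp_recovers n B {e\<in>node_pairs n. f e}}
      \<le> real n * exp (2 * (real n * ?p) - K * ln (real n)) + exp (- (?q * (real n)\<^sup>2 / 16))"
    proof (rule prob_sbm_recovers_le[OF B _ _ p1 _ \<open>L \<ge> 1\<close> _ small])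
      show "?q \<le> ?p" using n assms by (intro mult_right_mono) auto
      have "real n * ln (real n) * (2 / 3 * K / L) < real n * ln (real n) * (\<beta> / 16)"
        using cutc n by (intro mult_strict_left_mono) auto
      then show "2 / 3 * real n * (K * ln (real n)) / L < ?q * (real n)\<^sup>2 / 16"
        unfolding qn by (simp add: algebra_simps)
    qed (use n assms \<open>K > 0\<close> in auto)
    also have "2 * (real n * ?p) - K * ln (real n) = - ln (real n) + - ln (real n)"
      using n by (simp add: K_def algebra_simps)
    also have "exp (- ln (real n) + - ln (real n)) = inverse (real n) * inverse (real n)"
      unfolding exp_add using n by (simp add: exp_minus)
    also have "real n * (inverse (real n) * inverse (real n)) = 1 / real n"
      using n by (simp add: field_simps)
    finally show "measure_pmf.prob
      (Pi_pmf (node_pairs n) False (\<lambda>e. bernoulli_pmf (if same_part B e then ?p else ?q)))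
      {f. lp_recovers n B {e\<in>node_pairs n. f e}} \<le>
        1 / real n + exp (- (\<beta> * (real n * ln (real n)) / 16))"
      unfolding qn .
  qed
  have ev1: "eventually (\<lambda>n. \<alpha> * (ln (real n) / real n) \<le> 1) sequentially"
    using assms by real_asymp
  \<comment> \<open>Since \<open>L\<close> does not depend on \<open>n\<close>, this is a fixed
    number of powers of ln n, each negligible against n.\<close>
  have "((\<lambda>n. \<Sum>k<L. (K * ln (real n)) ^ k / real n) \<longlongrightarrow> (\<Sum>k<L. 0)) sequentially"
    using \<open>K > 0\<close> by (intro tendsto_sum) real_asymp
  then have "eventually (\<lambda>n. (\<Sum>k<L. (K * ln (real n)) ^ k / real n) < 1 / 16) sequentially"
    by (intro order_tendstoD(2)) auto
  then have ev2: "eventually (\<lambda>n. (\<Sum>k<L. (K * ln (real n)) ^ k) \<le> real n / 16) sequentially"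
    using eventually_gt_at_top[of 0]
    by eventually_elim (simp add: field_simps flip: sum_divide_distrib)
  \<comment> \<open>Evenness enters as a premise so that the statement transfers to the filter of
    even \<open>n\<close>.\<close>
  have "eventually (\<lambda>n. even n \<longrightarrow> ?lo n \<le> ?P n {(B, E). \<not> lp_recovers n B E}) sequentially"
    using ev1 ev2 eventually_ge_at_top[of 2]
  proof eventually_elim
    case (elim n)
    have compl: "{(B, E). \<not> lp_recovers n B E} = UNIV - {(B, E). lp_recovers n B E}" by auto
    have "?P n {(B, E). \<not> lp_recovers n B E} = 1 - ?P n {(B, E). lp_recovers n B E}"
      unfolding compl using measure_pmf.prob_compl by fastforce
    then show ?case using le1[of n] elim by auto
  qed
  then have ev: "eventually (\<lambda>n. ?lo n \<le> ?P n {(B, E). \<not> lp_recovers n B E}) ?F"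
    by (simp add: eventually_inf_principal)
  have "(?lo \<longlongrightarrow> 1) sequentially" using assms by real_asymp
  then have lim: "(?lo \<longlongrightarrow> 1) ?F" by (rule tendsto_mono[rotated]) simp
  show ?thesis
    by (rule tendsto_sandwich[OF ev _ lim tendsto_const]) (simp add: measure_pmf.prob_le_1)
qed

end
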